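(* Let $\mathcal{G}$ be the two-player augmented security game between the utility company $\mathcal{U}$ and the attacker $\mathcal{A}$ described in the context, with real parameters satisfying the standing assumptions listed there. If $$l^{\mathcal{U}}_{att\circ} - c^{\mathcal{A}}_{att\circ} = l^{\mathcal{U}}_{att} - c^{\mathcal{A}}_{att},$$ then $\mathcal{G}$ admits a unique pure Nash Equilibrium strategy profile, namely $s^* = (s^{\mathcal{U}}_{-mon}, s^{\mathcal{A}}_{att\circ})$; this equilibrium is non-strict, and the corresponding optimal (equilibrium) payoffs are $s^*_{\mathcal{U}} = -l^{\mathcal{U}}_{att\circ}$ for $\mathcal{U}$ and $s^*_{\mathcal{A}} = l^{\mathcal{U}}_{att\circ} - c^{\mathcal{A}}_{att\circ}$ for $\mathcal{A}$.
   Context: The game $\mathcal{G}$ is a two-player nonzero-sum complete-information game in normal form. Player $\mathcal{U}$ (utility company) has the pure strategies $S_{\mathcal{U}} = \{s^{\mathcal{U}}_{mon}, s^{\mathcal{U}}_{-mon}\}$ (monitor, do not monitor). Player $\mathcal{A}$ (attacker) has the pure strategies $S_{\mathcal{A}} = \{s^{\mathcal{A}}_{att\circ}, s^{\mathcal{A}}_{att}, s^{\mathcal{A}}_{-att}\}$ (weak attack, strong attack, no attack). Parameters (real numbers): $c^{\mathcal{U}}_{mon}$ (monitoring cost), $c^{\mathcal{U}}_{def}$ (defence cost), $l^{\mathcal{U}}_{att\circ}$ and $l^{\mathcal{U}}_{att}$ (losses of $\mathcal{U}$ from a weak and a strong attack, which are equal to the attacker's benefits), $c^{\mathcal{A}}_{att\circ}$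 and $c^{\mathcal{A}}_{att}$ (attacker's costs of a weak and a strong attack). Payoffs (payoff of $\mathcal{U}$, payoff of $\mathcal{A}$): - $(s^{\mathcal{U}}_{mon}, s^{\mathcal{A}}_{att\circ})$: $(-c^{\mathcal{U}}_{mon} - l^{\mathcal{U}}_{att\circ},\ l^{\mathcal{U}}_{att\circ} - c^{\mathcal{A}}_{att\circ})$ - $(s^{\mathcal{U}}_{mon}, s^{\mathcal{A}}_{att})$: $(-c^{\mathcal{U}}_{mon} - c^{\mathcal{U}}_{def},\ -c^{\mathcal{A}}_{att})$ - $(s^{\mathcal{U}}_{mon}, s^{\mathcal{A}}_{-att})$: $(-c^{\mathcal{U}}_{mon},\ 0)$ - $(s^{\mathcal{U}}_{-mon}, s^{\mathcal{A}}_{att\circ})$: $(-l^{\mathcal{U}}_{att\circ},\ l^{\mathcal{U}}_{att\circ} - c^{\mathcal{A}}_{att\circ})$ - $(s^{\mathcal{U}}_{-mon}, s^{\mathcal{A}}_{att})$: $(-l^{\mathcal{U}}_{att},\ l^{\mathcal{U}}_{att} - c^{\mathcal{A}}_{att})$ - $(s^{\mathcal{U}}_{-mon}, s^{\mathcal{A}}_{-att})$: $(0,\ 0)$ Standing assumptions: $l^{\mathcal{U}}_{att} > 0$; $c^{\mathcal{U}}_{mon} > 0$; $c^{\mathcal{A}}_{att} > 0$; $c^{\mathcal{U}}_{mon} + c^{\mathcal{U}}_{def} < l^{\mathcal{U}}_{att}$; $l^{\mathcal{U}}_{att} - c^{\mathcal{A}}_{att} > 0$; $c^{\mathcal{A}}_{att\circ}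 < l^{\mathcal{U}}_{att\circ}$; $c^{\mathcal{A}}_{att} > c^{\mathcal{A}}_{att\circ}$; $l^{\mathcal{U}}_{att} > l^{\mathcal{U}}_{att\circ}$. A pure strategy profile is a pure Nash Equilibrium if neither player can strictly increase their own payoff by a unilateral change of strategy. It is strict if every unilateral change to a different strategy strictly decreases the deviating player's payoff; otherwise it is non-strict. *)

theory Defs
  imports Complex_Main
begin

text \<open>
  A two-player normal-form game is given by its two payoff functions; the pure strategies of the
  two players are the elements of the types \<^typ>\<open>'u\<close> and \<^typ>\<open>'a\<close>.
\<close>

record ('u, 'a) game =
  payoff_U :: "'u \<times> 'a \<Rightarrow> real"
  payoff_A :: "'u \<times> 'a \<Rightarrow> real"

definition pure_nash :: "('u, 'a) game \<Rightarrow> 'u \<times> 'a \<Rightarrow> bool" where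
  "pure_nash G s \<longleftrightarrow>
     (\<forall>u. \<not> payoff_U G s < payoff_U G (u, snd s)) \<and>
     (\<forall>a. \<not> payoff_A G s < payoff_A G (fst s, a))"

definition strict_pure_nash :: "('u, 'a) game \<Rightarrow> 'u \<times> 'a \<Rightarrow> bool" where
  "strict_pure_nash G s \<longleftrightarrow>
     pure_nash G s \<and>
     (\<forall>u. u \<noteq> fst s \<longrightarrow> payoff_U G (u, snd s) < payoff_U G s) \<and>
     (\<forall>a. a \<noteq> snd s \<longrightarrow> payoff_A G (fst s, a) < payoff_A G s)"

definition non_strict_pure_nash :: "('u, 'a) game \<Rightarrow> 'u \<times> 'a \<Rightarrow> bool" where
  "non_strict_pure_nash G s \<longleftrightarrow> pure_nash G s \<and> \<not> strict_pure_nash G s"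

datatype utility_strategy = Mon | NoMon

datatype attacker_strategy = WeakAtt | StrongAtt | NoAtt

text \<open>
  Parameters: monitoring cost \<open>c_mon\<close>, defence cost \<open>c_def\<close>, losses \<open>l_weak\<close> and \<open>l_att\<close> of the
  utility company and costs \<open>k_weak\<close> and \<open>k_att\<close> of the attacker for a weak and a strong attack.
\<close>

fun utility_payoff ::
  "real \<Rightarrow> real \<Rightarrow> real \<Rightarrow> real \<Rightarrow> utility_strategy \<times> attacker_strategy \<Rightarrow> real" where
  "utility_payoff c_mon c_def l_weak l_att (Mon, WeakAtt) = - c_mon - l_weak"
| "utility_payoff c_mon c_def l_weak l_att (Mon, StrongAtt) = - c_mon - c_def"
| "utility_payoff c_mon c_def l_weak l_att (Mon, NoAtt) = - c_mon"
| "utility_payoff c_mon c_def l_weak l_att (NoMon, WeakAtt) = - l_weak"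
| "utility_payoff c_mon c_def l_weak l_att (NoMon, StrongAtt) = - l_att"
| "utility_payoff c_mon c_def l_weak l_att (NoMon, NoAtt) = 0"

fun attacker_payoff ::
  "real \<Rightarrow> real \<Rightarrow> real \<Rightarrow> real \<Rightarrow> utility_strategy \<times> attacker_strategy \<Rightarrow> real" where
  "attacker_payoff l_weak l_att k_weak k_att (Mon, WeakAtt) = l_weak - k_weak"
| "attacker_payoff l_weak l_att k_weak k_att (Mon, StrongAtt) = - k_att"
| "attacker_payoff l_weak l_att k_weak k_att (Mon, NoAtt) = 0"
| "attacker_payoff l_weak l_att k_weak k_att (NoMon, WeakAtt) = l_weak - k_weak"
| "attacker_payoff l_weak l_att k_weak k_att (NoMon, StrongAtt) = l_att - k_att"
| "attacker_payoff l_weak l_att k_weak k_att (NoMon, NoAtt) = 0"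

definition security_game ::
  "real \<Rightarrow> real \<Rightarrow> real \<Rightarrow> real \<Rightarrow> real \<Rightarrow> real \<Rightarrow> (utility_strategy, attacker_strategy) game" where
  "security_game c_mon c_def l_weak l_att k_weak k_att =
     \<lparr> payoff_U = utility_payoff c_mon c_def l_weak l_att,
       payoff_A = attacker_payoff l_weak l_att k_weak k_att \<rparr>"

end

theory Submission
  imports Defs
begin

text \<open>A weak attack earns \<open>l_weak - k_weak > 0\<close> whatever the utility does, so it
  always beats \<open>NoAtt\<close>, and under \<open>Mon\<close> it also beats
  \<open>StrongAtt\<close>, which earns \<open>- k_att < 0\<close>. Hence \<open>Mon\<close> could
  only be in equilibrium with \<open>WeakAtt\<close>, where dropping it saves \<open>c_mon\<close>.
  At \<open>(NoMon, StrongAtt)\<close> the utility prefers \<open>Mon\<close>, as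
  \<open>c_mon + c_def < l_att\<close>. Only \<open>(NoMon, WeakAtt)\<close> survives; it is stable
  because the two attacks tie there, and the same tie makes it non-strict.\<close>

theorem mainTheorem3:
  fixes c_mon c_def l_weak l_att k_weak k_att :: real
    and G :: "(utility_strategy, attacker_strategy) game"
  assumes G: "G = security_game c_mon c_def l_weak l_att k_weak k_att"
    and "l_att > 0"
    and "c_mon > 0"
    and "k_att > 0"
    and "c_mon + c_def < l_att"
    and "l_att - k_att > 0"
    and "k_weak < l_weak"
    and "k_att > k_weak"
    and "l_att > l_weak"
    and "l_weak - k_weak = l_att - k_att"
  shows "(\<exists>!s. pure_nash G s) \<and>
    pure_nash G (NoMon, WeakAtt) \<and>
    non_strict_pure_nash G (NoMon, WeakAtt) \<and>
    payoff_U G (NoMon, WeakAtt) = - l_weak \<and>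
    payoff_A G (NoMon, WeakAtt) = l_weak - k_weak"
proof -
  have nash_iff: "pure_nash G s \<longleftrightarrow> s = (NoMon, WeakAtt)" for s
  proof
    assume nash: "pure_nash G s"
    obtain u a where s: "s = (u, a)" by (cases s)
    have "\<not> payoff_U G s < payoff_U G (v, a)" "\<not> payoff_A G s < payoff_A G (u, b)" for v b
      using nash by (simp_all add: pure_nash_def s)
    \<comment> \<open>These deviations refute every other profile: the attacker never needs to be
      tested against anything but \<open>WeakAtt\<close>.\<close>
    from this(1)[of Mon] this(1)[of NoMon] this(2)[of WeakAtt]
    show "s = (NoMon, WeakAtt)"
      using assms by (cases u; cases a) (simp_all add: s security_game_def)
  next
    assume s: "s = (NoMon, WeakAtt)"
    have "\<not> payoff_U G s < payoff_U G (u, snd s)" for u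
      using assms by (cases u) (simp_all add: s security_game_def)
    moreover have "\<not> payoff_A G s < payoff_A G (fst s, a)" for a
      using assms by (cases a) (simp_all add: s security_game_def)
    ultimately show "pure_nash G s"
      by (simp add: pure_nash_def)
  qed
  \<comment> \<open>The equality of net gains enters as a tie: switching to \<open>StrongAtt\<close>
    costs the attacker nothing, which violates strictness.\<close>
  have "payoff_A G (NoMon, StrongAtt) = payoff_A G (NoMon, WeakAtt)"
    using assms by (simp add: security_game_def)
  then have "\<not> strict_pure_nash G (NoMon, WeakAtt)"
    by (auto simp: strict_pure_nash_def intro!: exI[of _ StrongAtt])
  then have "non_strict_pure_nash G (NoMon, WeakAtt)"
    by (simp add: nash_iff non_strict_pure_nash_def)
  moreover have "payoff_U G (NoMon, WeakAtt) = - l_weak" "payoff_A G (NoMon, WeakAtt) = l_weak - k_weak"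
    by (simp_all add: G security_game_def)
  ultimately show ?thesis
    by (simp add: nash_iff)
qed

end
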